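(* Let $n\ge 1$ and suppose $d_1\geq d_2\geq\dots\geq d_n>0$. Let $f_D$ be the function on $[0,1)$ whose value on the interval $[\frac{i-1}{n},\frac{i}{n})$ is $d_i$ for $i=1,\dots,n$. Then the first slide derivative of $f_D$ is given by $$\psi_1(f_D)=\frac{1}{n}\sum_{i=2}^{n-1}i\ln(i)\ln\left(\frac{d_{i+1}}{d_i}\right)+\frac{\ln(n)}{n}\sum_{i=1}^{n-1}\ln\left(\frac{d_i}{d_n}\right).$$
   Context: For a monotone decreasing (not necessarily strictly) function $f:(0,b)\rightarrow(0,\infty)$, put $A(t)=\int_0^b (f(x))^t\,dx$ and define the slide function $\sigma_f(t)=-1-\int_0^b \frac{(f(x))^t}{A(t)}\ln\left(x\frac{(f(x))^t}{A(t)}\right)dx$, with domain the set of all $t\geq 0$ at which $A$ and $\sigma_f$ both exist. If $\int_0^b (f(x))^s\,dx<\infty$ for some $s>0$, the $n$th slide derivative of $f$ is $\psi_n(f)=\frac{d^n\sigma_f}{dt^n}(0)$, where all derivatives are taken from the right. For $f_D$ one takes $b=1$ (the value at the endpoint $0$ is irrelevant). Empty sums are $0$. *)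

theory Defs
  imports "HOL-Analysis.Analysis"
begin

definition slide_admissible :: "real \<Rightarrow> (real \<Rightarrow> real) \<Rightarrow> bool" where
  "slide_admissible b f \<longleftrightarrow>
     0 < b \<and> antimono_on {0<..<b} f \<and> (\<forall>x\<in>{0<..<b}. 0 < f x)"

definition slide_A :: "real \<Rightarrow> (real \<Rightarrow> real) \<Rightarrow> real \<Rightarrow> real" where
  "slide_A b f t = (LINT x:{0<..<b}|lborel. f x powr t)"

definition slide_integrand :: "real \<Rightarrow> (real \<Rightarrow> real) \<Rightarrow> real \<Rightarrow> real \<Rightarrow> real" where
  "slide_integrand b f t x =
     (f x powr t / slide_A b f t) * ln (x * (f x powr t / slide_A b f t))"

text \<open>The slide function is a partial function; its domain consists of the \<open>t \<ge> 0\<close> at which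
  both defining integrals exist. Lebesgue integrability loses nothing here: \<open>f\<close> being
  decreasing, \<open>x * f x powr t \<le> slide_A b f t\<close>, so the second integrand is never positive.\<close>

definition slide_function :: "real \<Rightarrow> (real \<Rightarrow> real) \<Rightarrow> (real \<rightharpoonup> real)" where
  "slide_function b f t =
     (if 0 \<le> t \<and> set_integrable lborel {0<..<b} (\<lambda>x. f x powr t)
           \<and> set_integrable lborel {0<..<b} (slide_integrand b f t)
      then Some (- 1 - (LINT x:{0<..<b}|lborel. slide_integrand b f t x))
      else None)"

text \<open>A partial function is only differentiated from the right at points of its domain that have
  a right neighbourhood inside the domain.\<close>

definition has_right_deriv :: "(real \<rightharpoonup> real) \<Rightarrow> real \<Rightarrow> real \<Rightarrow> bool" where
  "has_right_deriv g t y \<longleftrightarrow>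
     t \<in> dom g \<and> eventually (\<lambda>s. s \<in> dom g) (at_right t) \<and>
     ((\<lambda>s. the (g s)) has_real_derivative y) (at_right t)"

definition right_deriv :: "(real \<rightharpoonup> real) \<Rightarrow> (real \<rightharpoonup> real)" where
  "right_deriv g t =
     (if \<exists>y. has_right_deriv g t y then Some (THE y. has_right_deriv g t y) else None)"

text \<open>The value \<open>None\<close> means that the \<open>n\<close>th slide derivative is undefined or does not exist.\<close>

definition slide_derivative :: "nat \<Rightarrow> real \<Rightarrow> (real \<Rightarrow> real) \<Rightarrow> real option" where
  "slide_derivative n b f =
     (if slide_admissible b f
           \<and> (\<exists>s>0. set_integrable lborel {0<..<b} (\<lambda>x. f x powr s))
      then (right_deriv ^^ n) (slide_function b f) 0
      else None)"

end

theory Submission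
  imports Defs "HOL-Real_Asymp.Real_Asymp"
begin

text \<open>
  Write \<open>l\<^sub>i = ln d\<^sub>i\<close>. The normalised power \<open>f\<^sub>D\<^sup>t / A(t)\<close> is a step function with values
  \<open>q\<^sub>i(t)\<close>. Splitting \<open>ln (x * q) = ln x + ln q\<close> and integrating \<open>ln\<close> by its
  antiderivative \<open>N(x) = x * ln x - x\<close> turns the slide function into a finite sum, smooth in \<open>t\<close>:
  \<open>\<sigma>(t) = -1 - (\<Sum>q\<^sub>i(t) * (N(i/n) - N((i-1)/n))) - 1/n * (\<Sum>q\<^sub>i(t) * ln (q\<^sub>i(t)))\<close>
  (lemma \<open>slide_function_step\<close>).

  At \<open>t = 0\<close> every \<open>q\<^sub>i\<close> equals 1 and has derivative \<open>l\<^sub>i - m\<close>, where \<open>m\<close> is the mean of the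
  \<open>l\<^sub>i\<close>. These deviations sum to zero, and since \<open>(q * ln q)' = q' * (ln q + 1)\<close>, the second
  sum contributes nothing to the derivative. What remains is
  \<open>- (\<Sum>(l\<^sub>i - m) * (N(i/n) - N((i-1)/n)))\<close>, in which the linear part of \<open>N\<close>, having equal
  increments, drops out too. Summation by parts moves the differences from \<open>N\<close> to \<open>l\<close>, and
  \<open>ln (i/n) = ln i - ln n\<close> separates the result into the two sums of the theorem.
\<close>

section \<open>Integration of step multiples\<close>

definition cell_index :: "nat \<Rightarrow> real \<Rightarrow> nat" where
  "cell_index n x = Suc (nat \<lfloor>x * n\<rfloor>)"

lemma mem_cell_iff:
  fixes x :: real and i n :: nat
  assumes "1 \<le> n" "0 \<le> x" "1 \<le> i"
  shows "x \<in> {(real i - 1) / n..<real i / n} \<longleftrightarrow> i = cell_index n x"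
proof -
  have "x \<in> {(real i - 1) / n..<real i / n} \<longleftrightarrow> real i - 1 \<le> x * n \<and> x * n < real i"
    using assms(1) by (simp add: field_simps)
  also have "\<dots> \<longleftrightarrow> \<lfloor>x * n\<rfloor> = int i - 1"
    by (subst floor_eq_iff) auto
  also have "\<dots> \<longleftrightarrow> i = cell_index n x"
    using assms by (auto simp: cell_index_def)
  finally show ?thesis .
qed

lemma cell_index_in:
  fixes x :: real and n :: nat
  assumes "1 \<le> n" "x \<in> {0<..<1}"
  shows "cell_index n x \<in> {1..n}"
    and "x \<in> {(real (cell_index n x) - 1) / n..<real (cell_index n x) / n}"
proof -
  have "x * n < n" using assms by simp
  then show "cell_index n x \<in> {1..n}"
    using assms by (simp add: cell_index_def Suc_le_eq nat_less_iff floor_less_iff)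
  show "x \<in> {(real (cell_index n x) - 1) / n..<real (cell_index n x) / n}"
    using assms by (subst mem_cell_iff) (auto simp: cell_index_def)
qed

text \<open>The cells are half-open while the integrals of \<open>h\<close> are over open intervals; the two
  differ only at the finitely many cell boundaries. Measurability of \<open>F\<close> comes from its
  pointwise expression through indicators of half-open cells.\<close>

lemma step_multiple_integral:
  fixes h F H :: "real \<Rightarrow> real" and c :: "nat \<Rightarrow> real" and n :: nat
  assumes n: "1 \<le> n"
    and h: "h \<in> borel_measurable borel"
    and int: "\<And>i. i \<in> {1..n} \<Longrightarrow> set_integrable lborel {(real i - 1) / n<..<real i / n} h"
    and val: "\<And>i. i \<in> {1..n} \<Longrightarrow>
          (LINT x:{(real i - 1) / n<..<real i / n}|lborel. h x) = H (real i / n) - H ((real i - 1) / n)"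
    and F: "\<And>i x. i \<in> {1..n} \<Longrightarrow> x \<in> {(real i - 1) / n..<real i / n} \<Longrightarrow> 0 < x \<Longrightarrow> F x = c i * h x"
  shows "set_integrable lborel {0<..<1} F" (is ?int)
    and "(LINT x:{0<..<1}|lborel. F x) = (\<Sum>i = 1..n. c i * (H (real i / n) - H ((real i - 1) / n)))"
      (is ?val)
proof -
  let ?C = "\<lambda>i. {(real i - 1) / n..<real i / n}"
  let ?O = "\<lambda>i. {(real i - 1) / n<..<real i / n}"
  let ?G = "\<lambda>x. \<Sum>i = 1..n. c i * (indicator (?O i) x * h x)"
  let ?K = "\<lambda>x. indicator {0<..<1} x * (\<Sum>i = 1..n. c i * (indicator (?C i) x * h x))"
  have cell: "indicator (?C i) x = (if i = cell_index n x then 1 else 0 :: real)"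
    if "0 \<le> x" "1 \<le> i" for x :: real and i
    using mem_cell_iff[OF n that] by (simp add: indicator_def)
  have FK: "indicator {0<..<1} x * F x = ?K x" for x
  proof (cases "x \<in> {0<..<1}")
    case True
    let ?j = "cell_index n x"
    have j: "?j \<in> {1..n}" "x \<in> ?C ?j" using cell_index_in[OF n True] by auto
    then have "F x = c ?j * h x" using F True by auto
    also have "\<dots> = (\<Sum>i = 1..n. if i = ?j then c i * h x else 0)"
      using j by simp
    also have "\<dots> = (\<Sum>i = 1..n. c i * (indicator (?C i) x * h x))"
      using True by (intro sum.cong refl) (simp add: cell)
    finally show ?thesis by simp
  qed auto
  have Gint: "integrable lborel ?G"
    using int by (auto intro!: Bochner_Integration.integrable_sum simp: set_integrable_def)
  have Gval: "integral\<^sup>L lborel ?G = (\<Sum>i = 1..n. c i * (H (real i / n) - H ((real i - 1) / n)))"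
    using int val
    by (subst Bochner_Integration.integral_sum)
      (auto intro!: sum.cong simp: set_integrable_def set_lebesgue_integral_def)
  let ?B = "(\<lambda>i. real i / n) ` {0..n}"
  have "AE x in lborel. x \<notin> ?B"
    by (intro AE_not_in finite_imp_null_set_lborel) auto
  then have AE: "AE x in lborel. ?K x = ?G x"
  proof eventually_elim
    case (elim x)
    have ind: "indicator {0<..<1} x * indicator (?C i) x = (indicator (?O i) x :: real)"
      if i: "i \<in> {1..n}" for i
    proof -
      have "x \<noteq> (real i - 1) / n"
        using elim i image_eqI[of x "\<lambda>i. real i / n" "i - 1" "{0..n}"] by (auto simp: of_nat_diff)
      moreover have "0 < x \<and> x < 1" if "x \<in> ?O i"
      proof -
        have "0 \<le> (real i - 1) / n" "real i / n \<le> 1" using i n by auto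
        with that show ?thesis by auto
      qed
      ultimately show ?thesis by (auto simp: indicator_def)
    qed
    have "?K x = (\<Sum>i = 1..n. c i * ((indicator {0<..<1} x * indicator (?C i) x) * h x))"
      by (simp add: sum_distrib_left mult_ac)
    also have "\<dots> = ?G x" using ind by (intro sum.cong) auto
    finally show ?case .
  qed
  have Kmeas: "?K \<in> borel_measurable lborel" and Gmeas: "?G \<in> borel_measurable lborel"
    using h by measurable
  have K: "integrable lborel ?K" "integral\<^sup>L lborel ?K = integral\<^sup>L lborel ?G"
    using integrable_cong_AE[OF Kmeas Gmeas AE] integral_cong_AE[OF Kmeas Gmeas AE] Gint by auto
  show ?int using K(1) by (simp add: set_integrable_def FK)
  show ?val using K(2) Gval by (simp add: set_lebesgue_integral_def FK)
qed

text \<open>The logarithm is unbounded when \<open>a = 0\<close>, but it does not change sign on the interval, so the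
  limits of the antiderivative at the endpoints decide integrability. The convention \<open>ln 0 = 0\<close>
  gives the antiderivative at 0 the value 0, which is its limit there.\<close>

lemma ln_integral_unit_interval:
  fixes a b :: real
  assumes "0 \<le> a" "a < b" "b \<le> 1"
  shows "set_integrable lborel {a<..<b} ln"
    and "(LINT x:{a<..<b}|lborel. ln x) = (b * ln b - b) - (a * ln a - a)"
proof -
  let ?N = "\<lambda>x::real. x - x * ln x"
  have lima: "(?N \<longlongrightarrow> ?N a) (at_right a)"
  proof (cases "a = 0")
    case True
    have "((\<lambda>x::real. x * ln x) \<longlongrightarrow> 0) (at_right 0)"
      by real_asymp
    then have "(?N \<longlongrightarrow> 0 - 0) (at_right 0)"
      by (intro tendsto_diff tendsto_ident_at)
    then show ?thesis using True by simp
  next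
    case False
    then show ?thesis using assms by (auto intro!: tendsto_eq_intros)
  qed
  have limb: "(?N \<longlongrightarrow> ?N b) (at_left b)"
    using assms by (auto intro!: tendsto_eq_intros)
  have ab: "ereal a < ereal b" using assms by simp
  have D: "DERIV ?N x :> - ln x" if "ereal a < ereal x" "ereal x < ereal b" for x
    using that assms by (auto intro!: derivative_eq_intros)
  have C: "isCont (\<lambda>x. - ln x) x" if "ereal a < ereal x" "ereal x < ereal b" for x
    using that assms by (auto intro!: continuous_intros)
  have P: "AE x in lborel. ereal a < ereal x \<longrightarrow> ereal x < ereal b \<longrightarrow> 0 \<le> - ln x"
    using assms by (intro AE_I2) auto
  have A: "((?N \<circ> real_of_ereal) \<longlongrightarrow> ?N a) (at_right (ereal a))"
    using lima by (simp add: ereal_tendsto_simps)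
  have B: "((?N \<circ> real_of_ereal) \<longlongrightarrow> ?N b) (at_left (ereal b))"
    using limb by (simp add: ereal_tendsto_simps)
  note FTC = interval_integral_FTC_nonneg[OF ab D C P A B]
  from FTC(1) have I: "set_integrable lborel {a<..<b} (\<lambda>x. - ln x)" by simp
  then show "set_integrable lborel {a<..<b} ln"
    by (simp add: set_integrable_def)
  from FTC(2) have "(LINT x:{a<..<b}|lborel. - ln x) = ?N b - ?N a"
    using assms by (simp add: interval_lebesgue_integral_def)
  then show "(LINT x:{a<..<b}|lborel. ln x) = (b * ln b - b) - (a * ln a - a)"
    by (simp add: set_lebesgue_integral_def)
qed

section \<open>The slide function of a step function\<close>

definition step_mean_power :: "nat \<Rightarrow> (nat \<Rightarrow> real) \<Rightarrow> real \<Rightarrow> real" where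
  "step_mean_power n d t = (\<Sum>i = 1..n. d i powr t) / n"

definition step_weight :: "nat \<Rightarrow> (nat \<Rightarrow> real) \<Rightarrow> nat \<Rightarrow> real \<Rightarrow> real" where
  "step_weight n d i t = d i powr t / step_mean_power n d t"

definition ln_primitive :: "real \<Rightarrow> real" where
  "ln_primitive x = x * ln x - x"

definition step_slide :: "nat \<Rightarrow> (nat \<Rightarrow> real) \<Rightarrow> real \<Rightarrow> real" where
  "step_slide n d t =
    - 1 - (\<Sum>i = 1..n. step_weight n d i t * (ln_primitive (real i / n) - ln_primitive ((real i - 1) / n)))
        - (\<Sum>i = 1..n. step_weight n d i t * ln (step_weight n d i t)) / n"

lemma step_mean_power_pos:
  assumes "1 \<le> n" "\<And>i. i \<in> {1..n} \<Longrightarrow> 0 < d i"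
  shows "0 < step_mean_power n d t"
  unfolding step_mean_power_def using assms
  by (intro divide_pos_pos sum_pos) (auto simp: less_imp_neq[symmetric])

lemma step_function_integral:
  fixes F :: "real \<Rightarrow> real"
  assumes "1 \<le> n"
    and "\<And>i x. i \<in> {1..n} \<Longrightarrow> x \<in> {(real i - 1) / n..<real i / n} \<Longrightarrow> 0 < x \<Longrightarrow> F x = c i"
  shows "set_integrable lborel {0<..<1} F"
    and "(LINT x:{0<..<1}|lborel. F x) = (\<Sum>i = 1..n. c i) / n"
proof -
  have int: "set_integrable lborel {(real i - 1) / n<..<real i / n} (\<lambda>_. 1 :: real)" for i
    by (simp add: set_integrable_def integrable_real_indicator emeasure_lborel_Ioo divide_right_mono)
  have val: "(LINT x:{(real i - 1) / n<..<real i / n}|lborel. 1 :: real) = real i / n - (real i - 1) / n" for i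
    by (simp add: set_lebesgue_integral_def divide_right_mono)
  have F: "F x = c i * 1" if "i \<in> {1..n}" "x \<in> {(real i - 1) / n..<real i / n}" "0 < x" for i x
    using assms(2) that by simp
  note S = step_multiple_integral[of n "\<lambda>_. 1" "\<lambda>x. x" F c, OF assms(1) _ int val F]
  show "set_integrable lborel {0<..<1} F" using S(1) by simp
  have "(LINT x:{0<..<1}|lborel. F x) = (\<Sum>i = 1..n. c i * (real i / n - (real i - 1) / n))"
    using S(2) by simp
  also have "\<dots> = (\<Sum>i = 1..n. c i / n)" by (intro sum.cong) (auto simp: field_simps)
  finally show "(LINT x:{0<..<1}|lborel. F x) = (\<Sum>i = 1..n. c i) / n"
    by (simp add: sum_divide_distrib)
qed

text \<open>On a cell the slide integrand is \<open>q\<^sub>i * ln x + q\<^sub>i * ln q\<^sub>i\<close>: a step multiple of \<open>ln\<close> plus a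
  step function.\<close>

lemma slide_function_step:
  fixes n :: nat and d :: "nat \<Rightarrow> real" and f :: "real \<Rightarrow> real"
  assumes n: "1 \<le> n" and pos: "\<And>i. i \<in> {1..n} \<Longrightarrow> 0 < d i"
    and f: "\<And>i x. i \<in> {1..n} \<Longrightarrow> x \<in> {(real i - 1) / n..<real i / n} \<Longrightarrow> f x = d i"
    and t: "0 \<le> t"
  shows "slide_function 1 f t = Some (step_slide n d t)"
proof -
  let ?q = "\<lambda>i. step_weight n d i t"
  have pw: "set_integrable lborel {0<..<1} (\<lambda>x. f x powr t)"
    "slide_A 1 f t = step_mean_power n d t"
    using step_function_integral[of n "\<lambda>x. f x powr t" "\<lambda>i. d i powr t"] n f
    by (auto simp: slide_A_def step_mean_power_def)
  let ?g = "\<lambda>x. f x powr t / slide_A 1 f t"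
  have g: "?g x = ?q i" if "i \<in> {1..n}" "x \<in> {(real i - 1) / n..<real i / n}" for i x
    using f[OF that] by (simp add: pw step_weight_def)
  have q: "0 < ?q i" if "i \<in> {1..n}" for i
    using pos[OF that] step_mean_power_pos[of n d t] n pos by (auto simp: step_weight_def)
  have cell: "0 \<le> (real i - 1) / n" "(real i - 1) / n < real i / n" "real i / n \<le> 1"
    if "i \<in> {1..n}" for i
    using that n by (auto simp: divide_strict_right_mono)
  have 1: "set_integrable lborel {0<..<1} (\<lambda>x. ?g x * ln x)"
    "(LINT x:{0<..<1}|lborel. ?g x * ln x) =
      (\<Sum>i = 1..n. ?q i * (ln_primitive (real i / n) - ln_primitive ((real i - 1) / n)))"
    using step_multiple_integral[of n ln ln_primitive "\<lambda>x. ?g x * ln x" ?q]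
      ln_integral_unit_interval[OF cell] n g by (auto simp: ln_primitive_def)
  have 2: "set_integrable lborel {0<..<1} (\<lambda>x. ?g x * ln (?g x))"
    "(LINT x:{0<..<1}|lborel. ?g x * ln (?g x)) = (\<Sum>i = 1..n. ?q i * ln (?q i)) / n"
    using step_function_integral[of n "\<lambda>x. ?g x * ln (?g x)" "\<lambda>i. ?q i * ln (?q i)"] n g by auto
  have split: "slide_integrand 1 f t x = ?g x * ln x + ?g x * ln (?g x)" if x: "x \<in> {0<..<1}" for x
  proof -
    have "0 < ?g x" using g[OF cell_index_in[OF n x]] q[OF cell_index_in(1)[OF n x]] by simp
    then have "ln (x * ?g x) = ln x + ln (?g x)" using x by (intro ln_mult_pos) auto
    then show ?thesis by (simp only: slide_integrand_def distrib_left)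
  qed
  have "set_integrable lborel {0<..<1} (\<lambda>x. ?g x * ln x + ?g x * ln (?g x))"
    by (rule set_integral_add[OF 1(1) 2(1)])
  moreover have "set_integrable lborel {0<..<1} (slide_integrand 1 f t) \<longleftrightarrow>
      set_integrable lborel {0<..<1} (\<lambda>x. ?g x * ln x + ?g x * ln (?g x))"
    by (rule set_integrable_cong) (use split in auto)
  moreover have "(LINT x:{0<..<1}|lborel. slide_integrand 1 f t x) =
      (LINT x:{0<..<1}|lborel. ?g x * ln x + ?g x * ln (?g x))"
    by (rule set_lebesgue_integral_cong) (use split in auto)
  ultimately have I: "set_integrable lborel {0<..<1} (slide_integrand 1 f t)"
    "(LINT x:{0<..<1}|lborel. slide_integrand 1 f t x) =
      (\<Sum>i = 1..n. ?q i * (ln_primitive (real i / n) - ln_primitive ((real i - 1) / n)))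
      + (\<Sum>i = 1..n. ?q i * ln (?q i)) / n"
    unfolding set_integral_add(2)[OF 1(1) 2(1)] 1(2) 2(2) by simp_all
  show ?thesis
    unfolding slide_function_def step_slide_def I(2) using t pw(1) I(1) by simp
qed

text \<open>A cell index that grows with \<open>x\<close> makes the step function inherit the monotonicity of
  \<open>d\<close>.\<close>

lemma slide_admissible_step:
  fixes n :: nat and d :: "nat \<Rightarrow> real" and f :: "real \<Rightarrow> real"
  assumes n: "1 \<le> n" and pos: "\<And>i. i \<in> {1..n} \<Longrightarrow> 0 < d i"
    and mono: "\<And>i j. 1 \<le> i \<Longrightarrow> i \<le> j \<Longrightarrow> j \<le> n \<Longrightarrow> d j \<le> d i"
    and f: "\<And>i x. i \<in> {1..n} \<Longrightarrow> x \<in> {(real i - 1) / n..<real i / n} \<Longrightarrow> f x = d i"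
  shows "slide_admissible 1 f"
proof -
  have j: "cell_index n x \<in> {1..n} \<and> f x = d (cell_index n x)" if "x \<in> {0<..<1}" for x
    using cell_index_in[OF n that] f by blast
  have "f y \<le> f x" if "x \<in> {0<..<1}" "y \<in> {0<..<1}" "x \<le> y" for x y
  proof -
    have "cell_index n x \<le> cell_index n y"
      using that by (auto simp: cell_index_def intro!: nat_mono floor_mono mult_right_mono)
    then show ?thesis using j[OF that(1)] j[OF that(2)] mono by auto
  qed
  moreover have "0 < f x" if "x \<in> {0<..<1}" for x using j[OF that] pos by auto
  ultimately show ?thesis by (auto simp: slide_admissible_def monotone_on_def)
qed

section \<open>The derivative at zero\<close>

lemma step_weight_zero:
  assumes "1 \<le> n" "\<And>i. i \<in> {1..n} \<Longrightarrow> 0 < d i" "i \<in> {1..n}"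
  shows "step_weight n d i 0 = 1"
proof -
  have "(\<Sum>k = 1..n. d k powr 0) = (\<Sum>k = 1..n. 1)"
    using assms(2) by (intro sum.cong) (auto simp: less_imp_neq[symmetric])
  then show ?thesis using assms(1) assms(2)[OF assms(3)]
    by (simp add: step_weight_def step_mean_power_def)
qed

lemma step_weight_deriv:
  assumes n: "1 \<le> n" and pos: "\<And>i. i \<in> {1..n} \<Longrightarrow> 0 < d i" and i: "i \<in> {1..n}"
  shows "(step_weight n d i has_real_derivative ln (d i) - (\<Sum>k = 1..n. ln (d k)) / n) (at 0)"
proof -
  have p: "((\<lambda>t. d k powr t) has_real_derivative ln (d k)) (at 0)" if "k \<in> {1..n}" for k
    using pos[OF that] by (auto intro!: derivative_eq_intros)
  have A: "(step_mean_power n d has_real_derivative (\<Sum>k = 1..n. ln (d k)) / n) (at 0)"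
    unfolding step_mean_power_def [abs_def]
    by (intro DERIV_cdivide DERIV_sum p)
  have A0: "step_mean_power n d 0 = 1"
    using step_weight_zero[OF n pos i] pos[OF i] by (simp add: step_weight_def)
  show ?thesis unfolding step_weight_def [abs_def]
    using DERIV_divide[OF p[OF i] A] A0 pos[OF i] by simp
qed

lemma summation_by_parts:
  fixes l M :: "nat \<Rightarrow> real"
  shows "(\<Sum>i = 1..Suc k. l i * (M i - M (i - 1)))
    = l (Suc k) * M (Suc k) - l 1 * M 0 - (\<Sum>i = 1..k. M i * (l (i + 1) - l i))"
  by (induction k) (auto simp: algebra_simps)

text \<open>Both the entropy sum and the linear part of \<open>ln_primitive\<close> contribute a multiple of
  \<open>\<Sum>i = 1..n. q\<^sub>i'(0)\<close>, which vanishes, so only \<open>x * ln x\<close> is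
  left of \<open>ln_primitive\<close>; there the mean \<open>m\<close> of the \<open>ln (d i)\<close> is multiplied by the telescoping
  \<open>1 * ln 1 - 0 * ln 0 = 0\<close>.\<close>

lemma step_slide_deriv:
  assumes n: "1 \<le> n" and pos: "\<And>i. i \<in> {1..n} \<Longrightarrow> 0 < d i"
  shows "(step_slide n d has_real_derivative
    - (\<Sum>i = 1..n. ln (d i) * (real i / n * ln (real i / n) - (real i - 1) / n * ln ((real i - 1) / n)))) (at 0)"
proof -
  define m where "m = (\<Sum>k = 1..n. ln (d k)) / n"
  define M where "M = (\<lambda>k::nat. real k / n * ln (real k / n))"
  have dev: "(\<Sum>i = 1..n. ln (d i) - m) = 0"
    using n by (simp add: sum_subtractf m_def)
  have q: "(step_weight n d i has_real_derivative ln (d i) - m) (at 0)" if "i \<in> {1..n}" for i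
    using step_weight_deriv[OF n pos that] by (simp add: m_def)
  have e: "((\<lambda>t. step_weight n d i t * ln (step_weight n d i t)) has_real_derivative ln (d i) - m) (at 0)"
    if "i \<in> {1..n}" for i
    using step_weight_zero[OF n pos that]
    by (auto intro!: derivative_eq_intros q[OF that])
  have D: "(step_slide n d has_real_derivative
      0 - (\<Sum>i = 1..n. (ln (d i) - m) * (ln_primitive (real i / n) - ln_primitive ((real i - 1) / n)))
        - (\<Sum>i = 1..n. ln (d i) - m) / n) (at 0)"
    unfolding step_slide_def [abs_def]
    by (intro DERIV_diff DERIV_const DERIV_sum DERIV_cdivide DERIV_cmult_right q e)
  have tele: "(\<Sum>i = 1..n. M i - M (i - 1)) = 0"
    using summation_by_parts[of "\<lambda>_. 1" M "n - 1"] n by (simp add: M_def)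
  have "(\<Sum>i = 1..n. (ln (d i) - m) * (ln_primitive (real i / n) - ln_primitive ((real i - 1) / n)))
      = (\<Sum>i = 1..n. ln (d i) * (M i - M (i - 1)) - m * (M i - M (i - 1)) - (ln (d i) - m) / n)"
    by (intro sum.cong) (auto simp: ln_primitive_def M_def of_nat_diff diff_divide_distrib algebra_simps)
  also have "\<dots> = (\<Sum>i = 1..n. ln (d i) * (M i - M (i - 1)))
      - m * (\<Sum>i = 1..n. M i - M (i - 1)) - (\<Sum>i = 1..n. ln (d i) - m) / n"
    unfolding sum_distrib_left sum_divide_distrib sum_subtractf[symmetric] ..
  also have "\<dots> = (\<Sum>i = 1..n. ln (d i) * (M i - M (i - 1)))"
    by (simp only: tele dev)
  also have "\<dots> = (\<Sum>i = 1..n. ln (d i) *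
      (real i / n * ln (real i / n) - (real i - 1) / n * ln ((real i - 1) / n)))"
    by (intro sum.cong) (auto simp: M_def of_nat_diff)
  finally show ?thesis using D dev by simp
qed

text \<open>The boundary terms vanish because \<open>x * ln x\<close> is zero at both 0 and 1. The part of
  \<open>ln (i/n)\<close> coming from \<open>ln n\<close> leads to \<open>\<Sum>i * (l\<^sub>i\<^sub>+\<^sub>1 - l\<^sub>i)\<close>, which a summation by parts in the
  opposite direction turns back into \<open>- (\<Sum>l\<^sub>i - l\<^sub>n)\<close>, with \<open>l\<^sub>i = ln (d i)\<close>.\<close>

lemma step_derivative_sum:
  fixes n :: nat and d :: "nat \<Rightarrow> real"
  assumes n: "1 \<le> n" and pos: "\<And>i. i \<in> {1..n} \<Longrightarrow> 0 < d i"
  shows "- (\<Sum>i = 1..n. ln (d i) * (real i / n * ln (real i / n) - (real i - 1) / n * ln ((real i - 1) / n)))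
    = 1 / real n * (\<Sum>i = 2..n - 1. real i * ln (real i) * ln (d (i + 1) / d i))
      + ln (real n) / real n * (\<Sum>i = 1..n - 1. ln (d i / d n))"
proof -
  define M where "M = (\<lambda>k::nat. real k / n * ln (real k / n))"
  define l where "l = (\<lambda>i. ln (d i))"
  obtain k where k: "n = Suc k" using n by (cases n) auto
  have quot: "ln (d i / d j) = l i - l j" if "i \<in> {1..n}" "j \<in> {1..n}" for i j
    using pos[OF that(1)] pos[OF that(2)] by (simp add: l_def ln_div)
  have "- (\<Sum>i = 1..n. ln (d i) * (real i / n * ln (real i / n) - (real i - 1) / n * ln ((real i - 1) / n)))
      = - (\<Sum>i = 1..Suc k. l i * (M i - M (i - 1)))"
    unfolding k[symmetric]
    by (intro arg_cong[where f = uminus] sum.cong) (auto simp: M_def l_def of_nat_diff)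
  also have "\<dots> = (\<Sum>i = 1..k. M i * (l (i + 1) - l i))"
    using n by (simp only: summation_by_parts) (simp add: M_def k)
  also have "\<dots> = (\<Sum>i = 1..k. 1 / n * (i * ln i * (l (i + 1) - l i)) - ln n / n * (i * (l (i + 1) - l i)))"
  proof (intro sum.cong refl)
    fix i assume "i \<in> {1..k}"
    then have *: "ln (real i / n) = ln i - ln n" using n by (intro ln_divide_pos) auto
    show "M i * (l (i + 1) - l i)
        = 1 / n * (i * ln i * (l (i + 1) - l i)) - ln n / n * (i * (l (i + 1) - l i))"
      unfolding M_def * by (simp add: algebra_simps diff_divide_distrib)
  qed
  also have "\<dots> = 1 / n * (\<Sum>i = 1..k. i * ln i * (l (i + 1) - l i))
      - ln n / n * (\<Sum>i = 1..k. i * (l (i + 1) - l i))"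
    by (simp only: sum_subtractf sum_distrib_left)
  also have "(\<Sum>i = 1..k. i * (l (i + 1) - l i)) = - (\<Sum>i = 1..k. l i - l n)"
    unfolding k by (induction k) (auto simp: algebra_simps sum_subtractf)
  also have "(\<Sum>i = 1..k. l i - l n) = (\<Sum>i = 1..n - 1. ln (d i / d n))"
    using quot by (intro sum.cong) (auto simp: k)
  \<comment> \<open>The term \<open>i = 1\<close> carries the factor \<open>ln 1 = 0\<close>.\<close>
  also have "(\<Sum>i = 1..k. i * ln i * (l (i + 1) - l i))
      = (\<Sum>i = 2..n - 1. i * ln i * (l (i + 1) - l i))"
    by (intro sum.mono_neutral_right) (auto simp: k)
  also have "\<dots> = (\<Sum>i = 2..n - 1. real i * ln i * ln (d (i + 1) / d i))"
    using quot by (intro sum.cong) auto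
  finally show ?thesis by simp
qed

lemma right_deriv_eq_Some:
  assumes "has_right_deriv g t y"
  shows "right_deriv g t = Some y"
proof -
  have "z = y" if "has_right_deriv g t z" for z
    using that assms tendsto_unique[OF trivial_limit_at_right_real]
    by (auto simp: has_right_deriv_def has_field_derivative_iff)
  with assms have "(THE z. has_right_deriv g t z) = y" by (intro the_equality)
  with assms show ?thesis by (auto simp: right_deriv_def)
qed

theorem theorem8:
  fixes n :: nat and d :: "nat \<Rightarrow> real" and f\<^sub>D :: "real \<Rightarrow> real"
  assumes "1 \<le> n"
    and "\<And>i. 1 \<le> i \<Longrightarrow> i < n \<Longrightarrow> d (i + 1) \<le> d i"
    and "0 < d n"
    and "\<And>i x. i \<in> {1..n} \<Longrightarrow> x \<in> {(real i - 1) / real n ..< real i / real n} \<Longrightarrow> f\<^sub>D x = d i"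
  shows "slide_derivative 1 1 f\<^sub>D =
    Some (1 / real n * (\<Sum>i = 2..n - 1. real i * ln (real i) * ln (d (i + 1) / d i))
          + ln (real n) / real n * (\<Sum>i = 1..n - 1. ln (d i / d n)))"
    (is "_ = Some ?y")
proof -
  have mono: "d j \<le> d i" if "1 \<le> i" "i \<le> j" "j \<le> n" for i j
    using that(2) that(3)
  proof (induction j rule: dec_induct)
    case (step k)
    then show ?case using assms(2)[of k] that(1) by auto
  qed simp
  have pos: "0 < d i" if "i \<in> {1..n}" for i
    using mono[of i n] that assms(3) by auto
  have slide: "slide_function 1 f\<^sub>D t = Some (step_slide n d t)" if "0 \<le> t" for t
    using slide_function_step[OF assms(1) pos assms(4) that] .
  have adm: "slide_admissible 1 f\<^sub>D"
    by (rule slide_admissible_step[OF assms(1) pos mono assms(4)])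
  have "set_integrable lborel {0<..<1} (\<lambda>x. f\<^sub>D x powr 1)"
    using assms by (intro step_function_integral[of n _ "\<lambda>i. d i powr 1"]) auto
  then have ex: "\<exists>s>0. set_integrable lborel {0<..<1} (\<lambda>x. f\<^sub>D x powr s)"
    by (intro exI[of _ 1]) auto
  \<comment> \<open>The difference quotient involves the value at 0 itself, so the two functions are exchanged
    within \<open>{0..}\<close> before passing to the right-hand filter.\<close>
  have "(step_slide n d has_real_derivative ?y) (at 0 within {0..})"
    using step_slide_deriv[of n d, OF assms(1) pos] step_derivative_sum[of n d, OF assms(1) pos]
    by (simp only: has_field_derivative_at_within)
  then have "((\<lambda>s. the (slide_function 1 f\<^sub>D s)) has_real_derivative ?y) (at 0 within {0..})"
    by (rule has_field_derivative_transform_within[where d = 1]) (auto simp: slide)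
  then have "((\<lambda>s. the (slide_function 1 f\<^sub>D s)) has_real_derivative ?y) (at_right 0)"
    by (rule has_field_derivative_subset) auto
  moreover have "eventually (\<lambda>s. s \<in> dom (slide_function 1 f\<^sub>D)) (at_right 0)"
    using eventually_at_right_less[of 0] by eventually_elim (auto simp: slide)
  ultimately have "has_right_deriv (slide_function 1 f\<^sub>D) 0 ?y"
    by (auto simp: has_right_deriv_def slide)
  then show ?thesis
    using adm ex by (simp add: slide_derivative_def right_deriv_eq_Some)
qed

end
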